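(* Let $\mathcal{X}\subseteq\mathbb{R}^n$ be a compact set, and let $f, h_1,\dots,h_m:\mathcal{X}\to\mathbb{R}$ be continuous functions such that $h_j(x)\ge 0$ for all $x\in\mathcal{X}$ and $j=1,\dots,m$. Then there is $y\in\mathbb{R}^m$ such that $(D_y)$ is a Lagrangian reformulation of $(P)$ if and only if the function $$x\mapsto \frac{(P)^*-f(x)}{\sum_{j=1}^m h_j(x)}$$ is bounded above on $\mathcal{X}\setminus\mathcal{H}$.
   Context: $\mathcal{H}$ denotes the set of points where $h_j(x)=0$ for all $j=1,\dots,m$ (so $\mathcal{X}\setminus\mathcal{H}$ is the set of $x\in\mathcal{X}$ with $h_j(x)\neq 0$ for some $j$). $(P)$ is the problem $\min\{f(x): h_j(x)=0,\ j=1,\dots,m,\ x\in\mathcal{X}\}$. For $y\in\mathbb{R}^m$, $(D_y)$ is the problem $\min_{x\in\mathcal{X}}\big(f(x)+\sum_{j=1}^m y_jh_j(x)\big)$. $(\cdot)^*$ denotes the optimal value of the problem $(\cdot)$, in the extended reals; the optimal value of an infeasible minimization problem is $+\infty$ (and a quotient with numerator $+\infty$ and positive denominator is $+\infty$, hence not bounded above). $(D_y)$ is a Lagrangian reformulation of $(P)$ if $(P)^*=(D_y)^*$. *)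

theory Defs
  imports "HOL-Analysis.Analysis"
begin

(* The infimum is taken in the extended reals, so an infeasible problem (S empty) has
   optimal value \<infinity>. *)
definition optimal_value :: "('a \<Rightarrow> real) \<Rightarrow> 'a set \<Rightarrow> ereal"
  where "optimal_value f S = (INF x\<in>S. ereal (f x))"

definition common_zeros :: "'a set \<Rightarrow> ('m \<Rightarrow> 'a \<Rightarrow> real) \<Rightarrow> 'a set"
  where "common_zeros X h = {x \<in> X. \<forall>j. h j x = 0}"

definition primal_value :: "'a set \<Rightarrow> ('a \<Rightarrow> real) \<Rightarrow> ('m \<Rightarrow> 'a \<Rightarrow> real) \<Rightarrow> ereal"
  where "primal_value X f h = optimal_value f (common_zeros X h)"

definition lagrangian_value ::
    "'a set \<Rightarrow> ('a \<Rightarrow> real) \<Rightarrow> ('m::finite \<Rightarrow> 'a \<Rightarrow> real) \<Rightarrow> real ^ 'm \<Rightarrow> ereal"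
  where "lagrangian_value X f h y = optimal_value (\<lambda>x. f x + (\<Sum>j\<in>UNIV. y $ j * h j x)) X"

definition is_lagrangian_reformulation ::
    "'a set \<Rightarrow> ('a \<Rightarrow> real) \<Rightarrow> ('m::finite \<Rightarrow> 'a \<Rightarrow> real) \<Rightarrow> real ^ 'm \<Rightarrow> bool"
  where "is_lagrangian_reformulation X f h y \<longleftrightarrow> primal_value X f h = lagrangian_value X f h y"

(* The bound has to be a real number: bdd_above is trivially true at type ereal. *)
definition real_bounded_above_on :: "('a \<Rightarrow> ereal) \<Rightarrow> 'a set \<Rightarrow> bool"
  where "real_bounded_above_on g S \<longleftrightarrow> (\<exists>B::real. \<forall>x\<in>S. g x \<le> ereal B)"

end

(* Weak duality (D_y)* <= (P)* always holds, so (D_y) is a Lagrangian reformulation of (P) iff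
   (P)* <= f(x) + sum_j y_j h_j(x) for every x in X, where only points outside the common zero
   set impose a condition. Since h_j >= 0, a vector y is dominated by the constant vector with
   entries B = sum_j |y_j|, and for constant vectors the condition says precisely that B is an
   upper bound of the quotient. The equivalence is pointwise in the extended reals, which also
   covers the case (P)* = +infinity. *)
theory Submission
  imports Defs
begin

lemma optimal_value_ge_iff: "c \<le> optimal_value f S \<longleftrightarrow> (\<forall>x\<in>S. c \<le> ereal (f x))"
  unfolding optimal_value_def by (rule le_INF_iff)

lemma primal_value_le:
  assumes "x \<in> common_zeros X h"
  shows "primal_value X f h \<le> ereal (f x)"
  using assms unfolding primal_value_def optimal_value_def by (rule INF_lower)

text \<open>Every feasible point of (P) lies in \<open>X\<close>, and the penalty term vanishes
  there, whatever the signs of \<open>y\<close> and \<open>h\<close>.\<close>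

lemma weak_duality: "lagrangian_value X f h y \<le> primal_value X f h"
  unfolding primal_value_def optimal_value_ge_iff
proof
  fix x assume x: "x \<in> common_zeros X h"
  then have "lagrangian_value X f h y \<le> ereal (f x + (\<Sum>j\<in>UNIV. y $ j * h j x))"
    unfolding lagrangian_value_def optimal_value_def common_zeros_def by (intro INF_lower) simp
  also have "\<dots> = ereal (f x)"
    using x by (simp add: common_zeros_def)
  finally show "lagrangian_value X f h y \<le> ereal (f x)" .
qed

lemma is_lagrangian_reformulation_iff:
  "is_lagrangian_reformulation X f h y \<longleftrightarrow>
    (\<forall>x \<in> X - common_zeros X h.
      primal_value X f h \<le> ereal (f x + (\<Sum>j\<in>UNIV. y $ j * h j x)))"
proof -
  have zeros: "primal_value X f h \<le> ereal (f x + (\<Sum>j\<in>UNIV. y $ j * h j x))"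
    if "x \<in> common_zeros X h" for x
    using primal_value_le[OF that, of f] that by (simp add: common_zeros_def)
  have "is_lagrangian_reformulation X f h y \<longleftrightarrow> primal_value X f h \<le> lagrangian_value X f h y"
    unfolding is_lagrangian_reformulation_def using weak_duality[of X f h y] by auto
  also have "\<dots> \<longleftrightarrow>
      (\<forall>x\<in>X. primal_value X f h \<le> ereal (f x + (\<Sum>j\<in>UNIV. y $ j * h j x)))"
    unfolding lagrangian_value_def by (rule optimal_value_ge_iff)
  finally show ?thesis
    using zeros by blast
qed

text \<open>For finite \<open>p\<close> this clears a positive denominator; for \<open>p\<close> =
  \<infinity> both sides fail, and for \<open>p\<close> = -\<infinity> both hold.\<close>

lemma ereal_diff_divide_le_iff:
  fixes p :: ereal and a b c :: real
  assumes "c > 0"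
  shows "(p - ereal a) / ereal c \<le> ereal b \<longleftrightarrow> p \<le> ereal (a + b * c)"
  using assms by (cases p) (auto simp: field_simps)

text \<open>Nonnegative terms cannot cancel, so one nonzero term suffices. This makes the
  denominator of the quotient positive.\<close>

lemma sum_pos_outside_common_zeros:
  fixes h :: "'m::finite \<Rightarrow> 'a \<Rightarrow> real"
  assumes "x \<in> X - common_zeros X h" and "\<And>j. h j x \<ge> 0"
  shows "(\<Sum>j\<in>UNIV. h j x) > 0"
proof -
  obtain j where "h j x \<noteq> 0"
    using assms(1) by (auto simp: common_zeros_def)
  then have "h j x > 0"
    using assms(2)[of j] by simp
  then show ?thesis
    using assms(2) by (intro sum_pos2[of UNIV j]) auto
qed

text \<open>As \<open>g\<close> is nonnegative, each coefficient may be raised to a common upper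
  bound. Absolute values make the sum of all entries such a bound.\<close>

lemma sum_mult_le_sum_abs_mult_sum:
  fixes y :: "real ^ 'm::finite"
  assumes "\<And>j. g j \<ge> 0"
  shows "(\<Sum>j\<in>UNIV. y $ j * g j) \<le> (\<Sum>j\<in>UNIV. \<bar>y $ j\<bar>) * (\<Sum>j\<in>UNIV. g j)"
proof -
  have "y $ j \<le> (\<Sum>i\<in>UNIV. \<bar>y $ i\<bar>)" for j
    using member_le_sum[of j UNIV "\<lambda>i. \<bar>y $ i\<bar>"] by auto
  then show ?thesis
    unfolding sum_distrib_left by (intro sum_mono mult_right_mono assms)
qed

theorem proposition3:
  fixes X :: "(real ^ 'n) set"
    and f :: "real ^ 'n \<Rightarrow> real"
    and h :: "'m::finite \<Rightarrow> real ^ 'n \<Rightarrow> real"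
  assumes "compact X"
    and "continuous_on X f"
    and "\<And>j. continuous_on X (h j)"
    and "\<And>j x. x \<in> X \<Longrightarrow> h j x \<ge> 0"
  shows "(\<exists>y :: real ^ 'm. is_lagrangian_reformulation X f h y) \<longleftrightarrow>
    real_bounded_above_on
      (\<lambda>x. (primal_value X f h - ereal (f x)) / ereal (\<Sum>j\<in>UNIV. h j x))
      (X - common_zeros X h)"
proof -
  let ?p = "primal_value X f h"
  let ?H = "\<lambda>x. \<Sum>j\<in>UNIV. h j x"
  let ?S = "X - common_zeros X h"
  have quotient: "(?p - ereal (f x)) / ereal (?H x) \<le> ereal B \<longleftrightarrow> ?p \<le> ereal (f x + B * ?H x)"
    if "x \<in> ?S" for x B
    using that assms(4) by (intro ereal_diff_divide_le_iff sum_pos_outside_common_zeros) auto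
  have "(\<exists>y :: real ^ 'm. is_lagrangian_reformulation X f h y) \<longleftrightarrow>
      (\<exists>B. \<forall>x\<in>?S. ?p \<le> ereal (f x + B * ?H x))"
  proof
    assume "\<exists>y :: real ^ 'm. is_lagrangian_reformulation X f h y"
    then obtain y :: "real ^ 'm"
      where y: "\<And>x. x \<in> ?S \<Longrightarrow> ?p \<le> ereal (f x + (\<Sum>j\<in>UNIV. y $ j * h j x))"
      by (auto simp: is_lagrangian_reformulation_iff)
    \<comment> \<open>The factor in front of \<open>?H x\<close> does not depend on
      \<open>x\<close>, so it can serve as a uniform \<open>B\<close>.\<close>
    have "?p \<le> ereal (f x + (\<Sum>j\<in>UNIV. \<bar>y $ j\<bar>) * ?H x)" if x: "x \<in> ?S" for x
    proof -
      have "(\<Sum>j\<in>UNIV. y $ j * h j x) \<le> (\<Sum>j\<in>UNIV. \<bar>y $ j\<bar>) * ?H x"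
        using x assms(4) by (intro sum_mult_le_sum_abs_mult_sum) auto
      then show ?thesis
        by (intro order_trans[OF y[OF x]]) simp
    qed
    then show "\<exists>B. \<forall>x\<in>?S. ?p \<le> ereal (f x + B * ?H x)"
      by blast
  next
    assume "\<exists>B. \<forall>x\<in>?S. ?p \<le> ereal (f x + B * ?H x)"
    then obtain B where "\<forall>x\<in>?S. ?p \<le> ereal (f x + B * ?H x)"
      by blast
    \<comment> \<open>With all multipliers equal to \<open>B\<close>, the penalty is exactly
      \<open>B * ?H x\<close>.\<close>
    then have "is_lagrangian_reformulation X f h (\<chi> j. B)"
      by (simp add: is_lagrangian_reformulation_iff sum_distrib_left)
    then show "\<exists>y :: real ^ 'm. is_lagrangian_reformulation X f h y"
      by blast
  qed
  also have "\<dots> \<longleftrightarrow> real_bounded_above_on (\<lambda>x. (?p - ereal (f x)) / ereal (?H x)) ?S"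
    unfolding real_bounded_above_on_def using quotient by simp
  finally show ?thesis .
qed

end
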